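(* Let $k,d\geq 1$ be integers and let $U(t)\in\mathbb{C}[t]$ be a polynomial of degree $e\leq kd-1$. Let $$P(t)=\frac{U(t)}{(1-t^k)^{d}}=\sum_{n\geq 0}H(n)t^n,$$ let $H_0,\ldots,H_{k-1}\in\mathbb{C}[x]$ be the constituents of the quasipolynomial $H$, and let $H_{\times}=\prod_{0\leq i\leq k-1}H_i$. For $0\leq i\leq k-1$ let $U_i(t)$ be the sum of all terms of $U(t)$ whose degree is congruent to $i$ modulo $k$. If $U_i\neq 0$ for all $0\leq i\leq k-1$, then every $n\in\{-1,-2,\ldots,-(dk-e-1)\}$ satisfies $H_{\times}(n)=0$.
   Context: Constituents: since $\deg U\leq kd-1$, for each $0\leq i\leq k-1$ there is a unique polynomial $H_i\in\mathbb{C}[x]$ (of degree at most $d-1$) such that $H(n)=H_i(n)$ for all integers $n\geq 0$ with $n\equiv i \pmod k$; these are the constituents $H_0,\ldots,H_{k-1}$ of $H$ (here $k$ is not required to be the minimal period). The product $H_\times$ is a polynomial, and $H_\times(n)$ denotes its value at $n$. If $dk-e-1=0$ the set $\{-1,\ldots,-(dk-e-1)\}$ is empty. *)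

theory Defs
  imports "HOL-Computational_Algebra.Computational_Algebra" Complex_Main
begin

(* The function H of the generating series: the division is that of formal power
   series, where (1 - t^k)^d is a unit because k > 0. *)
definition gen_coeff :: "nat \<Rightarrow> nat \<Rightarrow> complex poly \<Rightarrow> nat \<Rightarrow> complex" where
  "gen_coeff k d U n = fps_nth (fps_of_poly U / (1 - fps_X ^ k) ^ d) n"

definition is_constituent :: "nat \<Rightarrow> (nat \<Rightarrow> complex) \<Rightarrow> nat \<Rightarrow> complex poly \<Rightarrow> bool" where
  "is_constituent k f i p \<longleftrightarrow> (\<forall>n. n mod k = i \<longrightarrow> f n = poly p (of_nat n))"

(* Unspecified if f has no i-th constituent with respect to k; existence, uniqueness
   and the degree bound for f = gen_coeff k d U are gen_coeff_constituent below. *)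
definition constituent :: "nat \<Rightarrow> (nat \<Rightarrow> complex) \<Rightarrow> nat \<Rightarrow> complex poly" where
  "constituent k f i = (THE p. is_constituent k f i p)"

definition constituent_prod :: "nat \<Rightarrow> (nat \<Rightarrow> complex) \<Rightarrow> complex poly" where
  "constituent_prod k f = (\<Prod>i<k. constituent k f i)"

definition residue_part :: "nat \<Rightarrow> nat \<Rightarrow> complex poly \<Rightarrow> complex poly" where
  "residue_part k i U = (\<Sum>j | j \<le> degree U \<and> j mod k = i. monom (coeff U j) j)"

lemma is_constituent_unique:
  assumes "i < k" "is_constituent k f i p" "is_constituent k f i q"
  shows "p = q"
proof (rule ccontr)
  assume "p \<noteq> q"
  then have fin: "finite {x. poly (p - q) x = 0}"
    by (intro poly_roots_finite) simp
  have "(\<lambda>m. of_nat (i + k * m)) ` UNIV \<subseteq> {x. poly (p - q) x = 0}"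
  proof clarify
    fix m :: nat
    have "(i + k * m) mod k = i" using assms(1) by simp
    then have "poly p (of_nat (i + k * m)) = poly q (of_nat (i + k * m))"
      using assms(2,3) unfolding is_constituent_def by metis
    then show "poly (p - q) (of_nat (i + k * m)) = 0" by simp
  qed
  moreover have "inj (\<lambda>m. of_nat (i + k * m) :: complex)"
    using assms(1) by (auto intro!: injI simp del: of_nat_add of_nat_mult)
  ultimately show False
    using fin finite_subset finite_imageD infinite_UNIV_nat by blast
qed

lemma inverse_one_minus_X_power_nth:
  assumes "k > 0"
  shows "inverse ((1 - fps_X ^ k :: complex fps) ^ Suc s) =
    Abs_fps (\<lambda>n. if k dvd n then of_nat (n div k + s choose s) else 0)"
proof -
  define B :: "nat \<Rightarrow> complex fps" where
    "B = (\<lambda>s. Abs_fps (\<lambda>n. if k dvd n then of_nat (n div k + s choose s) else 0))"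
  have shift: "fps_nth (F * (1 - fps_X ^ k)) n =
      fps_nth F n - (if n < k then 0 else fps_nth F (n - k))" for F :: "complex fps" and n
    by (simp add: right_diff_distrib fps_X_power_mult_right_nth)
  have B0: "B 0 * (1 - fps_X ^ k) = 1"
    by (rule fps_ext) (use assms in \<open>auto simp: shift B_def dvd_minus_self dest: dvd_imp_le\<close>)
  have BS: "B (Suc s) * (1 - fps_X ^ k) = B s" for s
  proof (rule fps_ext)
    fix n
    show "fps_nth (B (Suc s) * (1 - fps_X ^ k)) n = fps_nth (B s) n"
    proof (cases "n < k \<or> \<not> k dvd n")
      case True
      then show ?thesis
        by (auto simp: shift B_def dvd_minus_self dest: dvd_imp_le)
    next
      case False
      then obtain q where n: "n = k * Suc q"
        using assms by (metis dvdE gr0_implies_Suc mult_0_right not_gr_zero)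
      have "n - k = k * q" using n by simp
      then show ?thesis
        using assms n by (simp add: shift B_def del: mult_Suc_right)
    qed
  qed
  have "B s * (1 - fps_X ^ k) ^ Suc s = 1"
  proof (induction s)
    case 0
    then show ?case using B0 by simp
  next
    case (Suc s)
    have "B (Suc s) * (1 - fps_X ^ k) ^ Suc (Suc s) =
        (B (Suc s) * (1 - fps_X ^ k)) * (1 - fps_X ^ k) ^ Suc s"
      by (simp only: power_Suc mult.assoc)
    also have "\<dots> = 1" by (simp only: BS Suc.IH)
    finally show ?case .
  qed
  then have "inverse ((1 - fps_X ^ k :: complex fps) ^ Suc s) = B s"
    by (metis fps_inverse_unique mult.commute)
  then show ?thesis by (simp add: B_def)
qed

lemma gen_coeff_constituent_exists:
  assumes "k > 0" "d > 0" "degree U < k * d" "i < k"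
  shows "\<exists>p. is_constituent k (gen_coeff k d U) i p \<and> degree p \<le> d - 1"
proof -
  obtain s where d: "d = Suc s" using assms(2) gr0_implies_Suc by blast
  define c :: "complex poly" where
    "c = smult (1 / fact s) (\<Prod>t=1..s. [:of_nat t, 1:])"
  have c_poly: "poly c x = (\<Prod>t=1..s. of_nat t + x) / fact s" for x
    by (simp add: c_def poly_prod)
  have c_nat: "poly c (of_nat q) = of_nat (q + s choose s)" for q
  proof -
    have P: "(\<Prod>t=1..s. t + q) * fact q = (fact (q + s) :: nat)"
      by (induction s) (simp_all add: algebra_simps)
    have "fact q * (\<Prod>t=1..s. t + q) = fact q * ((q + s choose s) * fact s :: nat)"
      using P binomial_fact_lemma[of s "q + s"] by (simp add: mult_ac)
    then have "(\<Prod>t=1..s. t + q) = (q + s choose s) * fact s"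
      by simp
    then have "of_nat (\<Prod>t=1..s. t + q) = (of_nat ((q + s choose s) * fact s) :: complex)"
      by (rule arg_cong)
    then have "(\<Prod>t=1..s. of_nat t + of_nat q :: complex) = of_nat (q + s choose s) * fact s"
      by (simp only: of_nat_prod of_nat_add of_nat_mult of_nat_fact)
    then show ?thesis by (simp add: c_poly)
  qed
  have c_neg: "poly c (- of_nat t) = 0" if "t \<in> {1..s}" for t
    using that by (auto simp: c_poly)
  have c_deg: "degree c \<le> s"
  proof -
    have "degree (\<Prod>t=1..s. [:of_nat t, 1 :: complex:]) \<le> (\<Sum>t=1..s. degree [:of_nat t, 1 :: complex:])"
      using degree_prod_sum_le[of "{1..s}" "\<lambda>t. [:of_nat t, 1 :: complex:]"] by (simp only: o_def finite_atLeastAtMost)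
    then show ?thesis by (simp add: c_def)
  qed
  define J where "J = {j. j < k * d \<and> j mod k = i}"
  have finJ: "finite J" by (simp add: J_def)
  define p where
    "p = (\<Sum>j\<in>J. smult (coeff U j) (pcompose c [:- of_nat j / of_nat k, 1 / of_nat k:]))"
  have "degree p \<le> s"
    unfolding p_def
  proof (rule degree_sum_le[OF finJ])
    fix j
    have "degree (pcompose c [:- of_nat j / of_nat k, 1 / of_nat k:]) \<le> s"
      using c_deg assms(1) by (simp add: degree_pcompose)
    then show "degree (smult (coeff U j) (pcompose c [:- of_nat j / of_nat k, 1 / of_nat k:])) \<le> s"
      by (meson degree_smult_le le_trans)
  qed
  moreover have "is_constituent k (gen_coeff k d U) i p"
    unfolding is_constituent_def
  proof (intro allI impI)
    fix n assume n: "n mod k = i"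
    define b :: "nat \<Rightarrow> complex" where
      "b = (\<lambda>m. if k dvd m then of_nat (m div k + s choose s) else 0)"
    have unit: "fps_nth ((1 - fps_X ^ k :: complex fps) ^ d) 0 \<noteq> 0"
      using assms(1) by simp
    have "gen_coeff k d U n = fps_nth (fps_of_poly U * inverse ((1 - fps_X ^ k) ^ d)) n"
      using unit by (simp add: gen_coeff_def fps_divide_unit)
    also have "\<dots> = (\<Sum>j=0..n. coeff U j * b (n - j))"
      unfolding d inverse_one_minus_X_power_nth[OF assms(1)] by (simp add: fps_mult_nth b_def)
    also have "\<dots> = (\<Sum>j\<in>J \<inter> {0..n}. coeff U j * b (n - j))"
    proof (rule sum.mono_neutral_right)
      show "\<forall>j\<in>{0..n} - J \<inter> {0..n}. coeff U j * b (n - j) = 0"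
      proof
        fix j assume j: "j \<in> {0..n} - J \<inter> {0..n}"
        show "coeff U j * b (n - j) = 0"
        proof (cases "j < k * d")
          case False
          then show ?thesis using assms(3) by (simp add: coeff_eq_0)
        next
          case True
          then have "\<not> k dvd n - j" using j n mod_eq_dvd_iff_nat[of j n k] by (auto simp: J_def)
          then show ?thesis by (simp add: b_def)
        qed
      qed
    qed auto
    also have "\<dots> = (\<Sum>j\<in>J \<inter> {0..n}. coeff U j * poly c ((of_nat n - of_nat j) / of_nat k))"
    proof (rule sum.cong[OF refl])
      fix j assume j: "j \<in> J \<inter> {0..n}"
      then have "k dvd n - j" using n mod_eq_dvd_iff_nat[of j n k] by (auto simp: J_def)
      then obtain q where q: "n - j = k * q" by blast
      then have "of_nat n - of_nat j = (of_nat k * of_nat q :: complex)"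
        using j by (metis Int_iff atLeastAtMost_iff of_nat_diff of_nat_mult)
      then show "coeff U j * b (n - j) = coeff U j * poly c ((of_nat n - of_nat j) / of_nat k)"
        using q assms(1) by (simp add: b_def c_nat)
    qed
    also have "\<dots> = (\<Sum>j\<in>J. coeff U j * poly c ((of_nat n - of_nat j) / of_nat k))"
    proof (rule sum.mono_neutral_left[OF finJ])
      show "\<forall>j\<in>J - J \<inter> {0..n}. coeff U j * poly c ((of_nat n - of_nat j) / of_nat k) = 0"
      proof
        fix j assume j: "j \<in> J - J \<inter> {0..n}"
        then have lt: "n < j" and J: "j < k * d" "j mod k = i" by (auto simp: J_def)
        then have "k dvd j - n" using n lt J mod_eq_dvd_iff_nat[of n j k] by simp
        then obtain q where q: "j - n = k * q" by blast
        have "q \<noteq> 0" using q lt by (cases q) simp_all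
        moreover have "k * q < k * Suc s" using J(1) unfolding q[symmetric] d[symmetric] by linarith
        then have "q \<le> s" by (simp only: mult_less_cancel1 less_Suc_eq_le)
        ultimately have "poly c (- of_nat q) = 0" by (intro c_neg) simp
        moreover have "j = n + k * q" using q lt by simp
        then have "(of_nat n - of_nat j) / of_nat k = (- of_nat q :: complex)"
          using assms(1) by simp
        ultimately show "coeff U j * poly c ((of_nat n - of_nat j) / of_nat k) = 0" by simp
      qed
    qed auto
    also have "\<dots> = poly p (of_nat n)"
      using assms(1) by (simp add: p_def poly_sum poly_pcompose diff_divide_distrib)
    finally show "gen_coeff k d U n = poly p (of_nat n)" .
  qed
  ultimately show ?thesis using d by auto
qed

lemma gen_coeff_constituent:
  assumes "k > 0" "d > 0" "degree U < k * d" "i < k"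
  shows "\<exists>!p. is_constituent k (gen_coeff k d U) i p"
    and "is_constituent k (gen_coeff k d U) i (constituent k (gen_coeff k d U) i)"
    and "degree (constituent k (gen_coeff k d U) i) \<le> d - 1"
proof -
  obtain p where p: "is_constituent k (gen_coeff k d U) i p" "degree p \<le> d - 1"
    using gen_coeff_constituent_exists[OF assms] by blast
  then show ex1: "\<exists>!p. is_constituent k (gen_coeff k d U) i p"
    using is_constituent_unique[OF assms(4)] by blast
  have "constituent k (gen_coeff k d U) i = p"
    unfolding constituent_def using ex1 p(1) by (rule the1_equality)
  then show "is_constituent k (gen_coeff k d U) i (constituent k (gen_coeff k d U) i)"
    and "degree (constituent k (gen_coeff k d U) i) \<le> d - 1"
    using p by simp_all
qed

end

theory Submission imports Defs begin

text \<open>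
  The idea is to read a value at a negative argument as a constant term. For \<open>m > 0\<close>,
  multiplying the generating series by \<open>t ^ m\<close> delays its coefficients by \<open>m\<close> places, so
  each constituent is replaced by its translate by \<open>m\<close>: if \<open>i + m \<equiv> 0 (mod k)\<close> and
  \<open>p\<close> is the constituent of the delayed sequence for the residue \<open>0\<close>, then
  \<open>H\<^sub>i(x) = p(x + m)\<close>. The numerator of the delayed series is \<open>t ^ m * U\<close>. As long as
  \<open>deg U + m < k * d\<close>, that is \<open>m \<le> d * k - e - 1\<close>, the delayed series is still a proper
  rational function, so its coefficients agree with their constituents from the index \<open>0\<close>
  onwards. Hence \<open>H\<^sub>i(- m) = p(0)\<close> is the constant term of \<open>t ^ m * P(t)\<close>, which vanishes.
  One vanishing factor makes the product of the constituents vanish at \<open>- m\<close>.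
\<close>

lemma gen_coeff_monom_mult:
  assumes "k > 0"
  shows "gen_coeff k d (monom 1 m * U) n = (if n < m then 0 else gen_coeff k d U (n - m))"
proof -
  have unit: "fps_nth ((1 - fps_X ^ k :: complex fps) ^ d) 0 \<noteq> 0"
    using assms by simp
  have "fps_of_poly (monom 1 m * U) / (1 - fps_X ^ k) ^ d =
      fps_X ^ m * (fps_of_poly U / (1 - fps_X ^ k) ^ d)"
    using unit by (simp add: fps_divide_unit fps_of_poly_mult fps_of_poly_monom mult.assoc)
  then show ?thesis
    by (simp add: gen_coeff_def fps_X_power_mult_nth)
qed

text \<open>
  The degree bound is what makes the delayed series proper, so that its constituent for the
  residue \<open>0\<close> describes all coefficients with index divisible by \<open>k\<close>, including the
  constant term.
\<close>

lemma constituent_vanishes_at_neg: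
  assumes "k > 0" "d > 0" "m > 0" "degree U + m < k * d"
    and "i < k" "(i + m) mod k = 0"
  shows "poly (constituent k (gen_coeff k d U) i) (- of_nat m) = 0"
proof -
  define V where "V = monom 1 m * U"
  define p where "p = constituent k (gen_coeff k d V) 0"
  have "degree V \<le> m + degree U"
    unfolding V_def by (metis degree_mult_le degree_monom_eq one_neq_zero)
  then have p: "is_constituent k (gen_coeff k d V) 0 p"
    unfolding p_def using assms by (intro gen_coeff_constituent(2)) simp_all
  have "is_constituent k (gen_coeff k d U) i (pcompose p [:of_nat m, 1:])"
    unfolding is_constituent_def
  proof (intro allI impI)
    fix n assume "n mod k = i"
    then have "(n + m) mod k = 0"
      using assms(6) by (metis mod_add_left_eq)
    then have "gen_coeff k d V (n + m) = poly p (of_nat (n + m))"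
      using p by (simp add: is_constituent_def)
    then show "gen_coeff k d U n = poly (pcompose p [:of_nat m, 1:]) (of_nat n)"
      using assms(1) by (simp add: V_def gen_coeff_monom_mult poly_pcompose add.commute)
  qed
  moreover have "is_constituent k (gen_coeff k d U) i (constituent k (gen_coeff k d U) i)"
    using assms by (intro gen_coeff_constituent(2)) simp_all
  ultimately have "constituent k (gen_coeff k d U) i = pcompose p [:of_nat m, 1:]"
    using assms(5) is_constituent_unique by blast
  then have "poly (constituent k (gen_coeff k d U) i) (- of_nat m) = poly p 0"
    by (simp add: poly_pcompose)
  also have "\<dots> = gen_coeff k d V 0"
    using p by (simp add: is_constituent_def)
  also have "\<dots> = 0"
    using assms(1,3) by (simp add: V_def gen_coeff_monom_mult)
  finally show ?thesis .
qed

theorem theorem3p4: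
  fixes k d e :: nat and U :: "complex poly" and n :: int
  assumes "k \<ge> 1" and "d \<ge> 1"
    and "degree U = e" and "e \<le> k * d - 1"
    and "\<forall>i<k. residue_part k i U \<noteq> 0"
    and "n \<in> {- (int d * int k - int e - 1) .. -1}"
  shows "poly (constituent_prod k (gen_coeff k d U)) (of_int n) = 0"
proof -
  define m where "m = nat (- n)"
  have n: "n = - int m" and m: "m > 0"
    using assms(6) by (simp_all add: m_def)
  have "int (e + m) < int (k * d)"
    using assms(6) n by (simp add: mult.commute)
  then have deg: "degree U + m < k * d"
    using assms(3) by linarith
  \<comment> \<open>The residue of \<open>- m\<close> modulo \<open>k\<close>, written without subtracting \<open>m\<close>.\<close>
  define i where "i = (m * (k - 1)) mod k"
  have i: "i < k"
    using assms(1) by (simp add: i_def)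
  have "(i + m) mod k = (m * (k - 1) + m) mod k"
    by (simp add: i_def mod_add_left_eq)
  also have "m * (k - 1) + m = m * k"
    using assms(1) by (cases k) simp_all
  finally have "(i + m) mod k = 0"
    by simp
  then have "poly (constituent k (gen_coeff k d U) i) (of_int n) = 0"
    using constituent_vanishes_at_neg[OF _ _ m deg i] assms(1,2) n by simp
  then show ?thesis
    using i by (auto simp: constituent_prod_def poly_prod)
qed

end
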